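(* For every even integer $n\ge 4$, $\chi'_L(K_n)=n+1$, where $K_n$ is the complete graph on $n$ vertices.
   Context: For a proper edge coloring $c:E(G)\to\{1,\dots,k\}$ of a connected graph $G$, let $\pi=(\mathcal{C}_1,\dots,\mathcal{C}_k)$ be the ordered partition of $E(G)$ into color classes. For a vertex $v$ and an edge $e=xy$, $d(v,e)=\min\{d(v,x),d(v,y)\}$, and $d(v,\mathcal{C}_i)=\min\{d(v,e): e\in\mathcal{C}_i\}$. The edge color code of $v$ is $c_\pi(v)=(d(v,\mathcal{C}_1),\dots,d(v,\mathcal{C}_k))$. The coloring $c$ is an edge-locating coloring if distinct vertices have distinct edge color codes; $\chi'_L(G)$ is the minimum $k$ for which $G$ has an edge-locating coloring with $k$ colors. *)

theory Defs
  imports Main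
begin

text \<open>
  Below, the distances are genuine minima only for connected graphs, and the distance to a
  colour class only for a nonempty class; \<open>LEAST\<close> and \<open>Min\<close> are underspecified otherwise.
\<close>

record 'a graph =
  verts :: "'a set"
  edges :: "'a set set"

definition walk :: "'a graph \<Rightarrow> 'a \<Rightarrow> 'a list \<Rightarrow> 'a \<Rightarrow> bool" where
  "walk G u p v \<longleftrightarrow>
     p \<noteq> [] \<and> hd p = u \<and> last p = v \<and> set p \<subseteq> verts G \<and>
     successively (\<lambda>x y. {x, y} \<in> edges G) p"

definition connected_graph :: "'a graph \<Rightarrow> bool" where
  "connected_graph G \<longleftrightarrow>
     finite (verts G) \<and> verts G \<noteq> {} \<and>
     (\<forall>e \<in> edges G. e \<subseteq> verts G \<and> card e = 2) \<and>
     (\<forall>u \<in> verts G. \<forall>v \<in> verts G. \<exists>p. walk G u p v)"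

text \<open>A walk is given by its vertices, so its length is one less than that of the list.\<close>

definition vdist :: "'a graph \<Rightarrow> 'a \<Rightarrow> 'a \<Rightarrow> nat" where
  "vdist G u v = (LEAST l. \<exists>p. walk G u p v \<and> length p = Suc l)"

definition edge_dist :: "'a graph \<Rightarrow> 'a \<Rightarrow> 'a set \<Rightarrow> nat" where
  "edge_dist G v e = Min (vdist G v ` e)"

definition class_dist :: "'a graph \<Rightarrow> 'a \<Rightarrow> 'a set set \<Rightarrow> nat" where
  "class_dist G v C = Min (edge_dist G v ` C)"

text \<open>
  All colours in \<open>{1..k}\<close> have to be used, because the colour classes are the blocks of a
  partition of the edge set into \<open>k\<close> (nonempty) parts.
\<close>

definition proper_edge_coloring :: "'a graph \<Rightarrow> nat \<Rightarrow> ('a set \<Rightarrow> nat) \<Rightarrow> bool" where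
  "proper_edge_coloring G k c \<longleftrightarrow>
     c ` edges G = {1..k} \<and>
     (\<forall>e \<in> edges G. \<forall>f \<in> edges G. e \<noteq> f \<and> e \<inter> f \<noteq> {} \<longrightarrow> c e \<noteq> c f)"

definition color_class :: "'a graph \<Rightarrow> ('a set \<Rightarrow> nat) \<Rightarrow> nat \<Rightarrow> 'a set set" where
  "color_class G c i = {e \<in> edges G. c e = i}"

definition edge_color_code :: "'a graph \<Rightarrow> nat \<Rightarrow> ('a set \<Rightarrow> nat) \<Rightarrow> 'a \<Rightarrow> nat list" where
  "edge_color_code G k c v = map (\<lambda>i. class_dist G v (color_class G c i)) [1..<Suc k]"

definition edge_locating_coloring :: "'a graph \<Rightarrow> nat \<Rightarrow> ('a set \<Rightarrow> nat) \<Rightarrow> bool" where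
  "edge_locating_coloring G k c \<longleftrightarrow>
     proper_edge_coloring G k c \<and> inj_on (edge_color_code G k c) (verts G)"

definition edge_locating_chromatic_number :: "'a graph \<Rightarrow> nat" where
  "edge_locating_chromatic_number G = (LEAST k. \<exists>c. edge_locating_coloring G k c)"

definition complete_graph :: "'a set \<Rightarrow> 'a graph" where
  "complete_graph V = \<lparr>verts = V, edges = {e. e \<subseteq> V \<and> card e = 2}\<rparr>"

lemma connected_complete_graph:
  assumes "finite V" and "V \<noteq> {}"
  shows "connected_graph (complete_graph V)"
proof -
  have "\<exists>p. walk (complete_graph V) u p v" if "u \<in> V" "v \<in> V" for u v
  proof (cases "u = v")
    case True
    then have "walk (complete_graph V) u [u] v"
      using that by (simp add: walk_def complete_graph_def)
    then show ?thesis ..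
  next
    case False
    then have "walk (complete_graph V) u [u, v] v"
      using that by (simp add: walk_def complete_graph_def)
    then show ?thesis ..
  qed
  then show ?thesis
    using assms by (simp add: connected_graph_def complete_graph_def)
qed

end

theory Submission
  imports Defs "HOL-Combinatorics.Transposition"
begin

text \<open>
  In a complete graph every distance is 0 or 1, so the code of a vertex records exactly which
  colours occur at it, and each vertex sees \<open>n - 1\<close> colours. With \<open>n\<close> colours the vertices would
  miss pairwise distinct single colours, so each colour would be missed exactly once and its
  class would be a perfect matching of \<open>n - 1\<close> vertices, which is impossible for even \<open>n\<close>.

  For \<open>m = n + 1\<close> colours, label the vertices by \<open>1, \<dots>, n\<close> and give \<open>xy\<close> the colour
  \<open>x + y mod m\<close>. Then \<open>v\<close> misses exactly \<open>v\<close> and \<open>2 v\<close>, and these pairs are distinct unless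
  \<open>m = 3 t\<close>, where \<open>t\<close> and \<open>2 t\<close> both miss \<open>{t, 2 t}\<close>. In that case the vertices above \<open>t\<close> form a
  Kempe chain for the colours \<open>t\<close> and \<open>t + 1\<close>, joining \<open>2 t\<close> to \<open>t + 1\<close>; exchanging the two
  colours along it separates all vertices.
\<close>

section \<open>Codes in complete graphs\<close>

definition seen_colors :: "'a graph \<Rightarrow> ('a set \<Rightarrow> 'b) \<Rightarrow> 'a \<Rightarrow> 'b set" where
  "seen_colors G c v = c ` {e \<in> edges G. v \<in> e}"

lemma verts_complete_graph [simp]: "verts (complete_graph V) = V"
  by (simp add: complete_graph_def)

lemma edges_complete_graph [simp]: "edges (complete_graph V) = {e. e \<subseteq> V \<and> card e = 2}"
  by (simp add: complete_graph_def)

lemma vdist_complete_graph: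
  assumes "u \<in> V" "v \<in> V"
  shows "vdist (complete_graph V) u v = of_bool (u \<noteq> v)"
proof (cases "u = v")
  case True
  have "walk (complete_graph V) u [u] v"
    using True assms by (simp add: walk_def)
  then have "vdist (complete_graph V) u v = 0"
    unfolding vdist_def by (intro Least_equality exI[of _ "[u]"]) auto
  then show ?thesis
    using True by simp
next
  case False
  have "walk (complete_graph V) u [u, v] v"
    using False assms by (simp add: walk_def)
  moreover have "1 \<le> l" if "walk (complete_graph V) u p v" "length p = Suc l" for p l
    using that False by (cases l) (auto simp: walk_def length_Suc_conv)
  ultimately have "vdist (complete_graph V) u v = 1"
    unfolding vdist_def by (intro Least_equality exI[of _ "[u, v]"]) auto
  then show ?thesis
    using False by simp
qed

lemma edge_dist_complete_graph:
  assumes "v \<in> V" "e \<in> edges (complete_graph V)"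
  shows "edge_dist (complete_graph V) v e = of_bool (v \<notin> e)"
proof -
  obtain x y where e: "e = {x, y}" "x \<in> V" "y \<in> V"
    using assms(2) by (auto simp: card_2_iff)
  show ?thesis
    using e assms(1) by (auto simp: edge_dist_def vdist_complete_graph)
qed

text \<open>A minimum of values in {0, 1} is 0 exactly when some edge of the class contains
  \<open>v\<close>. Nonemptiness of \<open>C\<close> keeps \<open>Min\<close> away from its
  unspecified value; for colour classes it comes from every colour in \<open>{1..k}\<close> being
  used.\<close>

lemma class_dist_complete_graph:
  assumes "finite V" "v \<in> V" "C \<subseteq> edges (complete_graph V)" "C \<noteq> {}"
  shows "class_dist (complete_graph V) v C = of_bool (v \<notin> \<Union> C)"
proof -
  have "finite C"
    using assms(1,3) by (auto intro: finite_subset[of _ "Pow V"])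
  have img: "edge_dist (complete_graph V) v ` C = (\<lambda>e. of_bool (v \<notin> e)) ` C"
    using assms(2,3) by (intro image_cong) (auto simp: edge_dist_complete_graph)
  show ?thesis
    unfolding class_dist_def img
    using \<open>finite C\<close> assms(4) by (intro Min_eqI) auto
qed

text \<open>Each code is the indicator vector of the colours missing at the vertex. No colour
  outside \<open>{1..k}\<close> occurs on an edge, so agreement in all entries already forces equal
  sets of seen colours.\<close>

lemma edge_color_code_eq_iff:
  assumes "finite V" "proper_edge_coloring (complete_graph V) k c" "u \<in> V" "v \<in> V"
  shows "edge_color_code (complete_graph V) k c u = edge_color_code (complete_graph V) k c v
    \<longleftrightarrow> seen_colors (complete_graph V) c u = seen_colors (complete_graph V) c v"
proof -
  let ?G = "complete_graph V"
  have col: "c ` edges ?G = {1..k}"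
    using assms(2) by (simp add: proper_edge_coloring_def)
  have dist: "class_dist ?G w (color_class ?G c i) = of_bool (i \<notin> seen_colors ?G c w)"
    if "w \<in> V" "i \<in> {1..k}" for w i
  proof -
    have "color_class ?G c i \<noteq> {}"
      using that(2) unfolding col[symmetric] color_class_def by blast
    moreover have "w \<in> \<Union> (color_class ?G c i) \<longleftrightarrow> i \<in> seen_colors ?G c w"
      by (auto simp: color_class_def seen_colors_def)
    ultimately show ?thesis
      using that assms(1) by (subst class_dist_complete_graph) (auto simp: color_class_def)
  qed
  have sub: "seen_colors ?G c w \<subseteq> {1..k}" for w
    using col by (auto simp: seen_colors_def simp del: edges_complete_graph)
  have "edge_color_code ?G k c u = edge_color_code ?G k c v \<longleftrightarrow>
      (\<forall>i\<in>{1..k}. class_dist ?G u (color_class ?G c i) = class_dist ?G v (color_class ?G c i))"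
    unfolding edge_color_code_def by auto
  also have "\<dots> \<longleftrightarrow> (\<forall>i\<in>{1..k}. i \<in> seen_colors ?G c u \<longleftrightarrow> i \<in> seen_colors ?G c v)"
    using assms(3,4) by (intro ball_cong) (auto simp: dist)
  also have "\<dots> \<longleftrightarrow> seen_colors ?G c u = seen_colors ?G c v"
    using sub by blast
  finally show ?thesis .
qed

lemma edge_locating_coloring_complete_graph_iff:
  assumes "finite V"
  shows "edge_locating_coloring (complete_graph V) k c \<longleftrightarrow>
    proper_edge_coloring (complete_graph V) k c \<and> inj_on (seen_colors (complete_graph V) c) V"
  using edge_color_code_eq_iff[OF assms]
  unfolding edge_locating_coloring_def inj_on_def by auto

lemma seen_colors_complete_graph:
  assumes "v \<in> V"
  shows "seen_colors (complete_graph V) c v = (\<lambda>y. c {v, y}) ` (V - {v})"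
proof -
  have "{e \<in> edges (complete_graph V). v \<in> e} = (\<lambda>y. {v, y}) ` (V - {v})"
    using assms by (auto simp: card_2_iff insert_commute)
  then show ?thesis
    by (simp add: seen_colors_def image_image del: edges_complete_graph)
qed

section \<open>Lower bound\<close>

text \<open>Complementation is injective on subsets of \<open>X\<close>. This passes from seen to
  missing colours in the lower bound, and from missing to seen colours in the construction.\<close>

lemma inj_on_Diff_left:
  assumes "inj_on M A" "\<And>v. v \<in> A \<Longrightarrow> M v \<subseteq> X"
  shows "inj_on (\<lambda>v. X - M v) A"
proof (rule inj_onI)
  fix u v assume uv: "u \<in> A" "v \<in> A" "X - M u = X - M v"
  then have "M u = M v"
    using assms(2)[of u] assms(2)[of v] by blast
  then show "u = v"
    using inj_onD[OF assms(1)] uv by blast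
qed

lemma proper_edge_coloringD:
  assumes "proper_edge_coloring G k c" "e \<in> edges G" "f \<in> edges G" "e \<inter> f \<noteq> {}" "c e = c f"
  shows "e = f"
  using assms by (auto simp: proper_edge_coloring_def)

lemma card_seen_colors:
  assumes "finite V" "proper_edge_coloring (complete_graph V) k c" "v \<in> V"
  shows "card (seen_colors (complete_graph V) c v) = card V - 1"
proof -
  have "inj_on (\<lambda>y. c {v, y}) (V - {v})"
  proof (rule inj_onI)
    fix x y assume xy: "x \<in> V - {v}" "y \<in> V - {v}" "c {v, x} = c {v, y}"
    have "{v, x} \<in> edges (complete_graph V)" "{v, y} \<in> edges (complete_graph V)"
      using xy assms(3) by auto
    then have "{v, x} = {v, y}"
      using proper_edge_coloringD[OF assms(2)] xy(3) by simp
    then show "x = y"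
      by (auto simp: doubleton_eq_iff)
  qed
  then show ?thesis
    using assms by (simp add: seen_colors_complete_graph card_image)
qed

text \<open>A colour class is a matching, and the vertices that see the colour are the endpoints of
  its edges, two for each edge.\<close>

lemma even_card_vertices_seeing_color:
  assumes "finite V" "proper_edge_coloring (complete_graph V) k c"
  shows "even (card {v \<in> V. i \<in> seen_colors (complete_graph V) c v})"
proof -
  let ?C = "color_class (complete_graph V) c i"
  have "{v \<in> V. i \<in> seen_colors (complete_graph V) c v} = \<Union> ?C"
    by (auto simp: color_class_def seen_colors_def)
  moreover have "card (\<Union> ?C) = (\<Sum>e\<in>?C. card e)"
  proof (rule card_Union_disjoint)
    show "pairwise disjnt ?C"
      unfolding pairwise_def disjnt_def color_class_def
      using proper_edge_coloringD[OF assms(2)] by (metis (mono_tags, lifting) mem_Collect_eq)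
    show "\<And>e. e \<in> ?C \<Longrightarrow> finite e"
      using assms(1) by (auto simp: color_class_def intro: finite_subset)
  qed
  moreover have "(\<Sum>e\<in>?C. card e) = (\<Sum>e\<in>?C. 2)"
    by (rule sum.cong) (auto simp: color_class_def)
  ultimately show ?thesis
    by simp
qed

lemma edge_locating_coloring_complete_graph_lower_bound:
  assumes "even (card V)" "card V \<ge> 2" "edge_locating_coloring (complete_graph V) k c"
  shows "card V + 1 \<le> k"
proof -
  let ?n = "card V" and ?S = "seen_colors (complete_graph V) c"
  have fin: "finite V"
    using assms(2) by (metis card.infinite not_numeral_le_zero)
  have proper: "proper_edge_coloring (complete_graph V) k c" and inj: "inj_on ?S V"
    using assms(3) by (auto simp: edge_locating_coloring_complete_graph_iff[OF fin])
  have sub: "?S v \<subseteq> {1..k}" for v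
    using proper by (auto simp: seen_colors_def proper_edge_coloring_def)
  have cardS: "card (?S v) = ?n - 1" if "v \<in> V" for v
    using card_seen_colors[OF fin proper that] .
  obtain u v where uv: "u \<in> V" "v \<in> V" "u \<noteq> v"
    using assms(2) by (metis card_le_Suc0_iff_eq[OF fin] not_less_eq_eq numeral_2_eq_2)
  have "?n - 1 \<le> k"
    using cardS[OF uv(1)] card_mono[OF _ sub[of u]] by simp
  moreover have "k \<noteq> ?n - 1"
  proof
    assume k: "k = ?n - 1"
    have "?S w = {1..k}" if "w \<in> V" for w
      using cardS[OF that] k by (intro card_subset_eq[OF _ sub]) auto
    then show False
      using uv inj by (metis inj_onD)
  qed
  moreover have "k \<noteq> ?n"
  proof
    assume k: "k = ?n"
    define M where "M v = {1..k} - ?S v" for v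
    have injM: "inj_on M V"
      unfolding M_def by (intro inj_on_Diff_left inj sub)
    have cardM: "card (M v) = 1" if "v \<in> V" for v
      using cardS[OF that] k assms(2) finite_subset[OF sub, of v]
      unfolding M_def by (subst card_Diff_subset[OF _ sub]) auto
    \<comment> \<open>Injectivity gives n different missing sets among only k = n singletons, so
      every singleton arises; in particular colour 1 is missed somewhere.\<close>
    have "M ` V = (\<lambda>i. {i}) ` {1..k}"
    proof (rule card_subset_eq)
      show "M ` V \<subseteq> (\<lambda>i. {i}) ` {1..k}"
      proof
        fix A assume "A \<in> M ` V"
        then obtain w where w: "w \<in> V" "A = M w"
          by blast
        then obtain i where "A = {i}"
          using cardM card_1_singletonE by metis
        moreover have "A \<subseteq> {1..k}"
          using w by (auto simp: M_def)
        ultimately show "A \<in> (\<lambda>i. {i}) ` {1..k}"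
          by blast
      qed
      show "card (M ` V) = card ((\<lambda>i. {i}) ` {1..k})"
        using injM k by (simp add: card_image)
    qed simp
    moreover have "1 \<in> {1..k}"
      using k assms(2) by simp
    ultimately obtain w where w: "w \<in> V" "M w = {1}"
      by (metis (no_types, lifting) image_iff)
    \<comment> \<open>Distinct vertices miss distinct singletons, so colour 1 is missed at
      \<open>w\<close> alone and its class would cover the odd number n - 1 of vertices.\<close>
    have "{v \<in> V. 1 \<in> ?S v} = V - {w}"
    proof -
      have "1 \<in> ?S v \<longleftrightarrow> v \<noteq> w" if v: "v \<in> V" for v
      proof -
        have "1 \<in> M v \<longleftrightarrow> M v = M w"
        proof -
          obtain j where "M v = {j}"
            using cardM[OF v] card_1_singletonE by blast
          then show ?thesis
            using w(2) by auto
        qed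
        moreover have "M v = M w \<longleftrightarrow> v = w"
          using injM v w(1) by (auto dest: inj_onD)
        moreover have "1 \<in> M v \<longleftrightarrow> 1 \<notin> ?S v"
          using \<open>1 \<in> {1..k}\<close> by (auto simp: M_def)
        ultimately show ?thesis
          by blast
      qed
      then show ?thesis
        by blast
    qed
    then have "even (?n - 1)"
      using even_card_vertices_seeing_color[OF fin proper, of 1] w(1) fin by simp
    then show False
      using assms(1,2) by (auto simp: even_diff_nat)
  qed
  ultimately show ?thesis
    by linarith
qed

section \<open>The construction\<close>

text \<open>The vertices are \<open>1, \<dots>, m - 1\<close>; the colours here are \<open>0, \<dots>, m - 1\<close>.\<close>

definition sum_coloring :: "nat \<Rightarrow> nat set \<Rightarrow> nat" where
  "sum_coloring m e = \<Sum> e mod m"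

text \<open>For labels above \<open>t\<close> and below \<open>3 * t\<close>, the colours
  \<open>t\<close> and \<open>t + 1\<close> belong to the sums \<open>4 * t\<close> and
  \<open>4 * t + 1\<close>. The two reflections compose to a shift by one, so these edges form a
  single path.\<close>

definition swapped_coloring :: "nat \<Rightarrow> nat set \<Rightarrow> nat" where
  "swapped_coloring t e =
     (if e \<subseteq> {t<..} then transpose t (t + 1) else id) (sum_coloring (3 * t) e)"

lemma sum_mod_eq:
  fixes x y m :: nat
  assumes "x < m" "y < m"
  shows "(x + y) mod m = (if x + y < m then x + y else x + y - m)"
  using assms by (auto simp: mod_if)

lemma sum_coloring_doubleton:
  assumes "x < m" "y < m" "x \<noteq> y"
  shows "sum_coloring m {x, y} = (if x + y < m then x + y else x + y - m)"
  using assms by (simp add: sum_coloring_def sum_mod_eq)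

text \<open>Row \<open>v\<close> of the addition table modulo \<open>m\<close> contains each residue
  once. Removing column 0, which is not a label, loses \<open>v\<close>; removing the diagonal loses
  \<open>2 * v\<close>.\<close>

lemma sum_coloring_seen:
  assumes "0 < v" "v < m"
  shows "(\<lambda>y. sum_coloring m {v, y}) ` ({1..<m} - {v}) = {0..<m} - {v, (2 * v) mod m}"
proof (intro equalityI subsetI)
  fix i assume "i \<in> (\<lambda>y. sum_coloring m {v, y}) ` ({1..<m} - {v})"
  then obtain y where "y \<in> {1..<m} - {v}" "i = sum_coloring m {v, y}"
    by blast
  then show "i \<in> {0..<m} - {v, (2 * v) mod m}"
    using assms sum_mod_eq[of v m v]
    by (auto simp: sum_coloring_doubleton mult_2 split: if_splits)
next
  fix i assume i: "i \<in> {0..<m} - {v, (2 * v) mod m}"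
  \<comment> \<open>This is i - v modulo \<open>m\<close>; it is nonzero because \<open>i\<close>
    differs from \<open>v\<close>, and it is not \<open>v\<close> because \<open>i\<close> differs
    from \<open>2 * v\<close> modulo \<open>m\<close>.\<close>
  define y where "y = (if v \<le> i then i - v else i + m - v)"
  have "y \<in> {1..<m} - {v}" "i = sum_coloring m {v, y}"
    using i assms sum_mod_eq[of v m v]
    by (auto simp: y_def sum_coloring_doubleton mult_2 split: if_splits)
  then show "i \<in> (\<lambda>y. sum_coloring m {v, y}) ` ({1..<m} - {v})"
    by blast
qed

lemma inj_sum_coloring:
  assumes "v < m"
  shows "inj_on (\<lambda>y. sum_coloring m {v, y}) ({1..<m} - {v})"
  by (rule inj_onI) (use assms in \<open>auto simp: sum_coloring_doubleton split: if_splits\<close>)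

text \<open>The final alternative ensures that the chosen edges keep their colours when
  \<open>t\<close> and \<open>t + 1\<close> are exchanged.\<close>

lemma sum_coloring_surj:
  assumes "5 \<le> m" "i < m"
  obtains x y where "x \<in> {1..<m}" "y \<in> {1..<m}" "x \<noteq> y" "sum_coloring m {x, y} = i"
    "x = 1 \<or> i \<le> 2"
proof -
  \<comment> \<open>For \<open>i\<close> at most 2, the pair 1, \<open>i - 1\<close> does not
    consist of two distinct labels, so the wrapped sums \<open>m\<close>, \<open>m + 1\<close>,
    \<open>m + 2\<close> are used; \<open>5 \<le> m\<close> keeps 3 and \<open>m - 1\<close>
    apart.\<close>
  consider "i = 0" | "i = 1" | "i = 2" | "3 \<le> i"
    by linarith
  then show thesis
  proof cases
    case 1
    then show ?thesis
      using assms by (intro that[of 1 "m - 1"]) (auto simp: sum_coloring_doubleton)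
  next
    case 2
    then show ?thesis
      using assms by (intro that[of 2 "m - 1"]) (auto simp: sum_coloring_doubleton)
  next
    case 3
    then show ?thesis
      using assms by (intro that[of 3 "m - 1"]) (auto simp: sum_coloring_doubleton)
  next
    case 4
    then show ?thesis
      using assms by (intro that[of 1 "i - 1"]) (auto simp: sum_coloring_doubleton)
  qed
qed

section \<open>The colouring after the exchange\<close>

text \<open>An edge with only one end above \<open>t\<close> has its sum between
  \<open>t + 2\<close> and \<open>4 * t - 1\<close>, hence neither exchanged colour. So around each
  vertex the new colouring is the old one followed by a permutation that depends on this vertex
  only.\<close>

lemma swapped_coloring_doubleton:
  assumes "0 < x" "x < 3 * t" "0 < y" "y < 3 * t" "x \<noteq> y"
  shows "swapped_coloring t {x, y} =
    (if t < x then transpose t (t + 1) else id) (sum_coloring (3 * t) {x, y})"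
proof (cases "t < x \<and> y \<le> t")
  case True
  then have "sum_coloring (3 * t) {x, y} \<notin> {t, t + 1}"
    using assms by (auto simp: sum_coloring_doubleton)
  then show ?thesis
    by (auto simp: swapped_coloring_def)
next
  case False
  then show ?thesis
    by (auto simp: swapped_coloring_def)
qed

lemma inj_swapped_coloring:
  assumes "0 < v" "v < 3 * t"
  shows "inj_on (\<lambda>y. swapped_coloring t {v, y}) ({1..<3 * t} - {v})"
proof -
  let ?f = "if t < v then transpose t (t + 1) else id"
  have "inj_on (?f \<circ> (\<lambda>y. sum_coloring (3 * t) {v, y})) ({1..<3 * t} - {v})"
    by (intro comp_inj_on inj_sum_coloring assms) (auto intro: inj_on_subset[OF inj_transpose])
  also have "?this \<longleftrightarrow> ?thesis"
    using assms by (intro inj_on_cong) (auto simp: swapped_coloring_doubleton)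
  finally show ?thesis .
qed

lemma swapped_coloring_seen:
  assumes "0 < v" "v < 3 * t" "2 \<le> t"
  shows "(\<lambda>y. swapped_coloring t {v, y}) ` ({1..<3 * t} - {v}) =
    {0..<3 * t} - (if t < v then transpose t (t + 1) else id) ` {v, (2 * v) mod (3 * t)}"
proof -
  let ?f = "if t < v then transpose t (t + 1) else id"
  have "(\<lambda>y. swapped_coloring t {v, y}) ` ({1..<3 * t} - {v})
      = ?f ` (\<lambda>y. sum_coloring (3 * t) {v, y}) ` ({1..<3 * t} - {v})"
    unfolding image_image using assms
    by (intro image_cong) (auto simp: swapped_coloring_doubleton)
  also have "\<dots> = ?f ` ({0..<3 * t} - {v, (2 * v) mod (3 * t)})"
    using assms by (subst sum_coloring_seen) auto
  also have "\<dots> = ?f ` {0..<3 * t} - ?f ` {v, (2 * v) mod (3 * t)}"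
    by (intro image_set_diff) auto
  \<comment> \<open>Both exchanged colours lie below \<open>3 * t\<close>, so the permutation
    preserves the range of colours.\<close>
  also have "?f ` {0..<3 * t} = {0..<3 * t}"
    using assms(3) by (auto simp: transpose_image_eq)
  finally show ?thesis .
qed

section \<open>Distinctness of the missing pairs\<close>

text \<open>Different vertices with the same pair would each be the double of the other modulo
  \<open>m\<close>, so 3u would be 0 modulo \<open>m\<close>. When 3 does not divide
  \<open>m\<close>, this makes u itself 0, which is not a label.\<close>

lemma sum_coloring_missing_inj:
  fixes m :: nat
  assumes "\<not> 3 dvd m"
  shows "inj_on (\<lambda>v. {v, (2 * v) mod m}) {1..<m}"
proof (rule inj_onI)
  fix u v assume uv: "u \<in> {1..<m}" "v \<in> {1..<m}" "{u, (2 * u) mod m} = {v, (2 * v) mod m}"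
  have "u = v" if "u = (2 * v) mod m" "v = (2 * u) mod m"
  proof -
    have uv_less: "u < m" "v < m"
      using uv(1,2) by auto
    have "u = (if v + v < m then v + v else v + v - m)"
      "v = (if u + u < m then u + u else u + u - m)"
      by (rule trans[OF that(1)[unfolded mult_2] sum_mod_eq[OF uv_less(2,2)]])
        (rule trans[OF that(2)[unfolded mult_2] sum_mod_eq[OF uv_less(1,1)]])
    moreover have "0 < u" "0 < v"
      using uv(1,2) by auto
    \<comment> \<open>If exactly one doubling wraps around, three times the smaller label is
      \<open>m\<close>. If none or both wrap, both labels are 0 or both are \<open>m\<close>, out of
      range.\<close>
    moreover have "3 * u \<noteq> m" "3 * v \<noteq> m"
      using assms by auto
    ultimately show ?thesis
      using uv_less by (simp only: split: if_splits)
  qed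
  then show "u = v"
    using uv(3) by (auto simp: doubleton_eq_iff)
qed

text \<open>Among the labels above \<open>t\<close>, only the ends \<open>t + 1\<close> and
  \<open>2 * t\<close> of the path miss one of the exchanged colours, so only their pairs
  change.\<close>

lemma swapped_coloring_missing:
  fixes t v :: nat
  assumes "odd t" "2 \<le> t" "0 < v" "v < 3 * t"
  shows "(if t < v then transpose t (t + 1) else id) ` {v, (2 * v) mod (3 * t)} =
    (if v = t + 1 then {t, 2 * t + 2} else if v = 2 * t then {2 * t, t + 1}
     else {v, if 2 * v < 3 * t then 2 * v else 2 * v - 3 * t})"
proof -
  \<comment> \<open>This gives \<open>2 * t + 2 < 3 * t\<close>, so that doubling
    \<open>t + 1\<close> does not wrap around.\<close>
  have t: "3 \<le> t"
    using assms(1,2) by (cases "t = 2") auto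
  have dbl: "(2 * v) mod (3 * t) = (if 2 * v < 3 * t then 2 * v else 2 * v - 3 * t)"
    using sum_mod_eq[of v "3 * t" v] assms(4) by (simp add: mult_2)
  consider "v \<le> t" | "v = t + 1" | "v = 2 * t" | "t + 1 < v" "v \<noteq> 2 * t"
    by linarith
  then show ?thesis
  proof cases
    case 4
    \<comment> \<open>Parity excludes the wrapped double \<open>t + 1\<close>; the wrapped double
      \<open>t\<close> would mean \<open>v = 2 * t\<close>.\<close>
    have "2 * v \<noteq> 4 * t + 1"
      by presburger
    then have "(2 * v) mod (3 * t) \<notin> {t, t + 1}"
      using 4 t unfolding dbl by auto
    then show ?thesis
      using 4 dbl by auto
  qed (use t dbl in auto)
qed

text \<open>Modulo \<open>3 * t\<close>, mutual doubles are only \<open>t\<close> and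
  \<open>2 * t\<close>, and the pair of \<open>2 * t\<close> has become
  \<open>{2 * t, t + 1}\<close>. An unchanged pair contains its own label, so it could equal this
  only at \<open>2 * t\<close> or \<open>t + 1\<close>, whose pairs did change. It could equal
  \<open>{t, 2 * t + 2}\<close> only at \<open>t\<close> or \<open>2 * t + 2\<close>, whose doubles
  are \<open>2 * t\<close> and \<open>t + 4\<close>.\<close>

lemma swapped_coloring_missing_inj:
  fixes t :: nat
  assumes "odd t" "2 \<le> t"
  shows "inj_on (\<lambda>v. (if t < v then transpose t (t + 1) else id) ` {v, (2 * v) mod (3 * t)})
    {1..<3 * t}"
proof (rule inj_onI)
  fix u v
  assume u: "u \<in> {1..<3 * t}" and v: "v \<in> {1..<3 * t}"
    and eq: "(if t < u then transpose t (t + 1) else id) ` {u, (2 * u) mod (3 * t)} =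
      (if t < v then transpose t (t + 1) else id) ` {v, (2 * v) mod (3 * t)}"
  have "0 < u" "u < 3 * t" "0 < v" "v < 3 * t"
    using u v by auto
  note missing = swapped_coloring_missing[OF assms this(1,2)]
    swapped_coloring_missing[OF assms this(3,4)]
  show "u = v"
    using eq assms \<open>0 < u\<close> \<open>0 < v\<close> \<open>u < 3 * t\<close> \<open>v < 3 * t\<close> unfolding missing
    by (simp only: doubleton_eq_iff split: if_splits) linarith+
qed

section \<open>Transfer to an arbitrary vertex set\<close>

text \<open>Reduces the construction to arithmetic on labels: properness becomes injectivity around
  each label, and \<open>Suc\<close> shifts the residues \<open>0, ..., m - 1\<close> to the
  required colours \<open>1, ..., m\<close>.\<close>

lemma edge_locating_coloring_complete_graph_of_labels:
  fixes g :: "nat set \<Rightarrow> nat"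
  assumes bij: "bij_betw \<phi> V {1..<m}"
    and range: "\<And>x y. x \<in> {1..<m} \<Longrightarrow> y \<in> {1..<m} \<Longrightarrow> x \<noteq> y \<Longrightarrow> g {x, y} < m"
    and surj: "\<And>i. i < m \<Longrightarrow> \<exists>x\<in>{1..<m}. \<exists>y\<in>{1..<m}. x \<noteq> y \<and> g {x, y} = i"
    and proper: "\<And>v. v \<in> {1..<m} \<Longrightarrow> inj_on (\<lambda>y. g {v, y}) ({1..<m} - {v})"
    and seen: "inj_on (\<lambda>v. (\<lambda>y. g {v, y}) ` ({1..<m} - {v})) {1..<m}"
  shows "edge_locating_coloring (complete_graph V) m (\<lambda>e. Suc (g (\<phi> ` e)))"
proof -
  let ?G = "complete_graph V" and ?c = "\<lambda>e. Suc (g (\<phi> ` e))"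
  have fin: "finite V"
    using bij bij_betw_finite by blast
  have inj\<phi>: "inj_on \<phi> V" and img: "\<phi> ` V = {1..<m}"
    using bij by (auto simp: bij_betw_def)
  have "?c ` edges ?G = {1..m}"
  proof (intro equalityI subsetI)
    fix j assume "j \<in> ?c ` edges ?G"
    then obtain x y where "x \<in> V" "y \<in> V" "x \<noteq> y" "j = ?c {x, y}"
      by (auto simp: card_2_iff)
    moreover from this have "\<phi> x \<in> {1..<m}" "\<phi> y \<in> {1..<m}" "\<phi> x \<noteq> \<phi> y"
      using inj\<phi> unfolding img[symmetric] by (auto simp: inj_on_eq_iff)
    ultimately show "j \<in> {1..m}"
      using range[of "\<phi> x" "\<phi> y"] by (simp add: Suc_le_eq)
  next
    fix j assume "j \<in> {1..m}"
    then have "j - 1 < m"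
      by auto
    from surj[OF this] obtain x y where
      xy: "x \<in> \<phi> ` V" "y \<in> \<phi> ` V" "x \<noteq> y" "g {x, y} = j - 1"
      unfolding img by blast
    then obtain a b where "a \<in> V" "b \<in> V" "x = \<phi> a" "y = \<phi> b"
      by blast
    then show "j \<in> ?c ` edges ?G"
      using xy \<open>j \<in> {1..m}\<close> by (intro image_eqI[of _ _ "{a, b}"]) (auto simp: card_insert_if)
  qed
  moreover have "e = f" if ef: "e \<in> edges ?G" "f \<in> edges ?G" "e \<inter> f \<noteq> {}" "?c e = ?c f" for e f
  proof -
    obtain v where v: "v \<in> e" "v \<in> f"
      using ef(3) by blast
    obtain x where x: "e = {v, x}" "x \<noteq> v" "x \<in> V"
      using ef(1) v(1) by (auto simp: card_2_iff)
    obtain y where y: "f = {v, y}" "y \<noteq> v" "y \<in> V"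
      using ef(2) v(2) by (auto simp: card_2_iff)
    have "v \<in> V"
      using ef(1) v(1) by auto
    then have "\<phi> v \<in> {1..<m}" "\<phi> x \<in> {1..<m} - {\<phi> v}" "\<phi> y \<in> {1..<m} - {\<phi> v}"
      using x y inj\<phi> unfolding img[symmetric] by (auto simp: inj_on_eq_iff)
    moreover have "g {\<phi> v, \<phi> x} = g {\<phi> v, \<phi> y}"
      using ef(4) x y by simp
    ultimately have "\<phi> x = \<phi> y"
      using proper by (meson inj_onD)
    then show ?thesis
      using x y inj\<phi> by (auto simp: inj_on_eq_iff)
  qed
  ultimately have "proper_edge_coloring ?G m ?c"
    unfolding proper_edge_coloring_def by blast
  moreover have "inj_on (seen_colors ?G ?c) V"
  proof (rule inj_onI)
    have seen_eq: "seen_colors ?G ?c v = Suc ` (\<lambda>y. g {\<phi> v, y}) ` ({1..<m} - {\<phi> v})"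
      if "v \<in> V" for v
    proof -
      have "{1..<m} - {\<phi> v} = \<phi> ` (V - {v})"
        using that inj\<phi> img by (auto simp: inj_on_eq_iff)
      then show ?thesis
        using that by (simp add: seen_colors_complete_graph image_image)
    qed
    fix u v assume uv: "u \<in> V" "v \<in> V" "seen_colors ?G ?c u = seen_colors ?G ?c v"
    then have "(\<lambda>y. g {\<phi> u, y}) ` ({1..<m} - {\<phi> u}) = (\<lambda>y. g {\<phi> v, y}) ` ({1..<m} - {\<phi> v})"
      by (simp add: seen_eq inj_image_eq_iff)
    moreover have "\<phi> u \<in> {1..<m}" "\<phi> v \<in> {1..<m}"
      using uv(1,2) unfolding img[symmetric] by auto
    ultimately have "\<phi> u = \<phi> v"
      by (rule inj_onD[OF seen])
    then show "u = v"
      using uv inj\<phi> by (simp add: inj_on_eq_iff)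
  qed
  ultimately show ?thesis
    by (simp add: edge_locating_coloring_complete_graph_iff[OF fin])
qed

lemma edge_locating_coloring_complete_graph_exists:
  assumes "even (card V)" "card V \<ge> 4"
  shows "\<exists>c. edge_locating_coloring (complete_graph V) (card V + 1) c"
proof -
  define m where "m = card V + 1"
  have m: "odd m" "5 \<le> m"
    using assms by (auto simp: m_def)
  have "finite V"
    using assms(2) by (metis card.infinite not_numeral_le_zero)
  then obtain \<phi> where \<phi>: "bij_betw \<phi> V {1..<m}"
    using finite_same_card_bij[of V "{1..<m}"] unfolding m_def by auto
  show ?thesis
  proof (cases "3 dvd m")
    case False
    have "edge_locating_coloring (complete_graph V) m (\<lambda>e. Suc (sum_coloring m (\<phi> ` e)))"
    proof (rule edge_locating_coloring_complete_graph_of_labels[OF \<phi>])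
      show "sum_coloring m {x, y} < m" for x y
        using m by (simp add: sum_coloring_def)
      show "\<exists>x\<in>{1..<m}. \<exists>y\<in>{1..<m}. x \<noteq> y \<and> sum_coloring m {x, y} = i" if "i < m" for i
        by (rule sum_coloring_surj[OF m(2) that]) blast
      show "inj_on (\<lambda>y. sum_coloring m {v, y}) ({1..<m} - {v})" if "v \<in> {1..<m}" for v
        using that by (intro inj_sum_coloring) auto
      have "inj_on (\<lambda>v. {0..<m} - {v, (2 * v) mod m}) {1..<m}"
        by (intro inj_on_Diff_left sum_coloring_missing_inj False) auto
      then show "inj_on (\<lambda>v. (\<lambda>y. sum_coloring m {v, y}) ` ({1..<m} - {v})) {1..<m}"
        by (rule inj_on_cong[THEN iffD1, rotated]) (subst sum_coloring_seen; simp)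
    qed
    then show ?thesis
      unfolding m_def by blast
  next
    case True
    then obtain t where t: "m = 3 * t"
      by blast
    \<comment> \<open>Evenness of the order enters here: \<open>m\<close> is odd, hence so is
      \<open>t\<close>, as the parity argument for the exchanged colours requires.\<close>
    then have t': "odd t" "3 \<le> t"
      using m by (auto elim: oddE)
    have "edge_locating_coloring (complete_graph V) m (\<lambda>e. Suc (swapped_coloring t (\<phi> ` e)))"
    proof (rule edge_locating_coloring_complete_graph_of_labels[OF \<phi>], unfold t)
      show "swapped_coloring t {x, y} < 3 * t" for x y
        using t' by (auto simp: swapped_coloring_def sum_coloring_def transpose_def)
      show "\<exists>x\<in>{1..<3 * t}. \<exists>y\<in>{1..<3 * t}. x \<noteq> y \<and> swapped_coloring t {x, y} = i"
        if i: "i < 3 * t" for i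
      proof -
        obtain x y where xy: "x \<in> {1..<3 * t}" "y \<in> {1..<3 * t}" "x \<noteq> y"
          "sum_coloring (3 * t) {x, y} = i" "x = 1 \<or> i \<le> 2"
          by (rule sum_coloring_surj[of "3 * t" i]) (use t' i in auto)
        \<comment> \<open>An edge at label 1 is not contained in the labels above \<open>t\<close>,
          and a colour at most 2 is below \<open>t\<close>; either way the exchange leaves it
          alone.\<close>
        have "swapped_coloring t {x, y} = i"
          using xy t' by (auto simp: swapped_coloring_def)
        then show ?thesis
          using xy by blast
      qed
      show "inj_on (\<lambda>y. swapped_coloring t {v, y}) ({1..<3 * t} - {v})"
        if "v \<in> {1..<3 * t}" for v
        using that by (intro inj_swapped_coloring) auto
      have "inj_on (\<lambda>v. {0..<3 * t} -
          (if t < v then transpose t (t + 1) else id) ` {v, (2 * v) mod (3 * t)}) {1..<3 * t}"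
        using t'
        by (intro inj_on_Diff_left swapped_coloring_missing_inj) (auto simp: transpose_def)
      then show "inj_on (\<lambda>v. (\<lambda>y. swapped_coloring t {v, y}) ` ({1..<3 * t} - {v})) {1..<3 * t}"
        by (rule inj_on_cong[THEN iffD1, rotated])
          (use t' in \<open>subst swapped_coloring_seen; simp\<close>)
    qed
    then show ?thesis
      unfolding m_def by blast
  qed
qed

theorem theorem8:
  fixes V :: "'a set" and n :: nat
  assumes "even n" and "n \<ge> 4" and "card V = n"
  shows "edge_locating_chromatic_number (complete_graph V) = n + 1"
  unfolding edge_locating_chromatic_number_def
proof (rule Least_equality)
  show "\<exists>c. edge_locating_coloring (complete_graph V) (n + 1) c"
    using edge_locating_coloring_complete_graph_exists[of V] assms by simp
  show "n + 1 \<le> k" if "\<exists>c. edge_locating_coloring (complete_graph V) k c" for k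
    using edge_locating_coloring_complete_graph_lower_bound[of V k] that assms by auto
qed

end
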